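(* In the robust peak load pricing model with fixed demand and uncertain variable costs (defined in the context), the optimal objective values of the robust central planner and of the adjustable robust central planner are equal, i.e. $C_R=C_{AR}$.
   Context: Let $\mathcal{N}=\{1,\dots,N\}$ (producers) and $\mathcal{T}=\{1,\dots,T\}$ (time periods). Data: investment costs $c^{\mathrm{inv}}_i\ge 0$, nominal variable costs $c^{\mathrm{var}}_i\ge 0$, scaling factors $a_i\ge 0$ ($i\in\mathcal{N}$), fixed demands $d_t\ge 0$ ($t\in\mathcal{T}$). The uncertainty set $\mathcal{U}\subseteq[0,1]^{N\times T}$ is a convex polytope with $0\in\mathcal{U}$, whose projection onto every coordinate axis is $[0,1]$, and which is a Cartesian product $\mathcal{U}=\prod_{t\in\mathcal{T}}\mathcal{U}'$ for some $\mathcal{U}'\subseteq[0,1]^N$. For $y\in\mathbb{R}^N_{\ge 0}$ let $F(y)=\{x\in\mathbb{R}^{N\times T}_{\ge 0} : x_{i,t}\le y_i\ \forall i,t,\ \sum_{i\in\mathcal{N}}x_{i,t}=d_t\ \forall t\}$, and let $K(x,y,u)=\sum_{i\in\mathcal{N}}\big(c^{\mathrm{inv}}_iy_i+\sum_{t\in\mathcal{T}}(c^{\mathrm{var}}_i+a_iu_{i,t})x_{i,t}\big)$. Robust central planner: $C_R:=\min_{y\ge 0,\ x\in F(y)}\ \max_{u\in\mathcal{U}}K(x,y,u)$. Adjustable robust central planner: $C_{AR}:=\min_{y\ge 0}\ \max_{u\in\mathcal{U}}\ \min_{x\in F(y)}K(x,y,u)$, where a minimum over an empty set is $+\infty$.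 *)

theory Defs
  imports "HOL-Analysis.Analysis"
begin

text \<open>
  Producers and time periods are the elements of two finite types \<open>'n\<close> and \<open>'t\<close>.  A vector
  indexed by (producer, period) is a matrix \<open>x :: real^'t^'n\<close> whose entry \<open>x $ i $ t\<close> is
  \<open>x\<^sub>i\<^sub>,\<^sub>t\<close>; its column \<open>t\<close> is the vector of all producers' values in period \<open>t\<close>.
\<close>

definition feasible_productions ::
    "real^'t \<Rightarrow> real^'n \<Rightarrow> (real^'t^'n) set" where
  "feasible_productions d y =
     {x. (\<forall>i t. 0 \<le> x $ i $ t) \<and> (\<forall>i t. x $ i $ t \<le> y $ i) \<and>
         (\<forall>t. (\<Sum>i\<in>UNIV. x $ i $ t) = d $ t)}"

definition total_cost ::
    "real^'n \<Rightarrow> real^'n \<Rightarrow> real^'n \<Rightarrow> real^'t^'n \<Rightarrow> real^'n \<Rightarrow> real^'t^'n \<Rightarrow> real" where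
  "total_cost cinv cvar a x y u =
     (\<Sum>i\<in>UNIV. cinv $ i * y $ i +
        (\<Sum>t\<in>UNIV. (cvar $ i + a $ i * u $ i $ t) * x $ i $ t))"

definition uncertainty_set :: "(real^'t^'n) set \<Rightarrow> bool" where
  "uncertainty_set U \<longleftrightarrow>
     polytope U \<and>
     (\<forall>u\<in>U. \<forall>i t. 0 \<le> u $ i $ t \<and> u $ i $ t \<le> 1) \<and>
     0 \<in> U \<and>
     (\<forall>i t. (\<lambda>u. u $ i $ t) ` U = {0..1}) \<and>
     (\<exists>U' \<subseteq> {v :: real^'n. \<forall>i. 0 \<le> v $ i \<and> v $ i \<le> 1}. U = {u. \<forall>t. column t u \<in> U'})"

text \<open>
  Optimal values are extended reals, so that an infeasible minimization has value \<open>\<infinity>\<close>.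
\<close>

definition C_R ::
    "real^'n \<Rightarrow> real^'n \<Rightarrow> real^'n \<Rightarrow> real^'t \<Rightarrow> (real^'t^'n) set \<Rightarrow> ereal" where
  "C_R cinv cvar a d U =
     (INF (y, x) \<in> {(y, x). (\<forall>i. 0 \<le> y $ i) \<and> x \<in> feasible_productions d y}.
        SUP u\<in>U. ereal (total_cost cinv cvar a x y u))"

definition C_AR ::
    "real^'n \<Rightarrow> real^'n \<Rightarrow> real^'n \<Rightarrow> real^'t \<Rightarrow> (real^'t^'n) set \<Rightarrow> ereal" where
  "C_AR cinv cvar a d U =
     (INF y \<in> {y. \<forall>i. 0 \<le> y $ i}. SUP u\<in>U.
        INF x \<in> feasible_productions d y. ereal (total_cost cinv cvar a x y u))"

end

theory Submission
  imports Defs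
begin

text \<open>
  For fixed capacities the production costs are bilinear in the production plan and the
  realised variable costs, both of which range over compact convex sets, so the minimum over
  productions and the maximum over uncertainties may be exchanged.  The required saddle point is
  a Brouwer fixed point of a projected gradient step.
\<close>

text \<open>The residual at a projection makes a non-acute angle with every direction into
  \<open>S\<close>. At a fixed point of the step by \<open>v\<close> the residual is
  \<open>v\<close> itself, so \<open>z\<close> maximises \<open>v\<close> over
  \<open>S\<close>.\<close>

lemma closest_point_eq_self_dot:
  fixes S :: "'a::euclidean_space set"
  assumes "convex S" "closed S" "closest_point S (z + v) = z" "z' \<in> S"
  shows "v \<bullet> z' \<le> v \<bullet> z"
  using closest_point_dot[OF assms(1,2,4), of "z + v"] assms(3)
  by (simp add: inner_diff_right)

lemma bilinear_saddle_point:
  fixes X W :: "'a::euclidean_space set"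
  assumes X: "compact X" "convex X" "X \<noteq> {}"
    and W: "compact W" "convex W" "W \<noteq> {}"
  obtains x w where "x \<in> X" "w \<in> W"
    "\<And>x'. x' \<in> X \<Longrightarrow> w \<bullet> x \<le> w \<bullet> x'"
    "\<And>w'. w' \<in> W \<Longrightarrow> w' \<bullet> x \<le> w \<bullet> x"
proof -
  have clX: "closed X" and clW: "closed W"
    using X W by (auto intro: compact_imp_closed)
  \<comment> \<open>For the payoff \<open>w \<bullet> x\<close> the gradient in \<open>x\<close> is
    \<open>w\<close> and the gradient in \<open>w\<close> is \<open>x\<close>: \<open>g\<close>
    descends in the first component, ascends in the second, and projects back. Step size 1 suffices,
    since only a fixed point is sought, not convergence.\<close>
  define g where
    "g = (\<lambda>p. (closest_point X (fst p + - snd p), closest_point W (snd p + fst p)))"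
  have "continuous_on (X \<times> W) g"
    unfolding g_def
    by (intro continuous_on_Pair
        continuous_on_compose2[OF continuous_on_closest_point[OF X(2) clX X(3), of UNIV]]
        continuous_on_compose2[OF continuous_on_closest_point[OF W(2) clW W(3), of UNIV]]
        continuous_intros) auto
  moreover have "g \<in> X \<times> W \<rightarrow> X \<times> W"
    using closest_point_in_set[OF clX X(3)] closest_point_in_set[OF clW W(3)]
    by (auto simp: g_def)
  ultimately obtain p where p: "p \<in> X \<times> W" "g p = p"
    using brouwer[of "X \<times> W" g] X W by (auto simp: compact_Times convex_Times)
  obtain x w where xw: "p = (x, w)" by (cases p)
  \<comment> \<open>With \<open>v = - w\<close> the first equation says that \<open>x\<close>
    minimises against \<open>w\<close>; with \<open>v = x\<close> the second says that
    \<open>w\<close> maximises against \<open>x\<close>.\<close>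
  have fixX: "closest_point X (x + - w) = x" and fixW: "closest_point W (w + x) = w"
    using p(2) by (auto simp: g_def xw)
  show thesis
  proof
    show "x \<in> X" "w \<in> W" using p(1) xw by auto
    show "w \<bullet> x \<le> w \<bullet> x'" if "x' \<in> X" for x'
      using closest_point_eq_self_dot[OF X(2) clX fixX that] by simp
    show "w' \<bullet> x \<le> w \<bullet> x" if "w' \<in> W" for w'
      using closest_point_eq_self_dot[OF W(2) clW fixW that] by (simp add: inner_commute)
  qed
qed

lemma convex_feasible_productions: "convex (feasible_productions d y)"
proof (rule convexI)
  fix x z :: "real^'a^'b" and r s :: real
  assume x: "x \<in> feasible_productions d y" and z: "z \<in> feasible_productions d y"
    and rs: "0 \<le> r" "0 \<le> s" "r + s = 1"
  have "r * x $ i $ t + s * z $ i $ t \<le> y $ i" for i t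
    using x z rs by (intro convex_bound_le) (auto simp: feasible_productions_def)
  moreover have "(\<Sum>i\<in>UNIV. r * x $ i $ t + s * z $ i $ t) = d $ t" for t
  proof -
    have "(\<Sum>i\<in>UNIV. r * x $ i $ t + s * z $ i $ t) = (r + s) * d $ t"
      using x z
      by (simp add: feasible_productions_def sum.distrib distrib_right flip: sum_distrib_left)
    then show ?thesis using rs by simp
  qed
  ultimately show "r *\<^sub>R x + s *\<^sub>R z \<in> feasible_productions d y"
    using x z rs by (auto simp: feasible_productions_def)
qed

lemma compact_feasible_productions: "compact (feasible_productions d y)"
proof -
  \<comment> \<open>Sign and capacity constraints cut out a box, which is compact; the demand
    equations cut out a closed set.\<close>
  have "feasible_productions d y =
      cbox 0 (\<chi> i t. y $ i) \<inter> {x. \<forall>t. (\<Sum>i\<in>UNIV. x $ i $ t) = d $ t}"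
    by (auto simp: feasible_productions_def mem_box_cart interval_cbox_cart less_eq_vec_def
        cbox_def Basis_vec_def inner_axis)
  moreover have "closed {x :: real^'a^'b. \<forall>t. (\<Sum>i\<in>UNIV. x $ i $ t) = d $ t}"
    by (intro closed_Collect_all closed_Collect_eq continuous_intros)
  ultimately show ?thesis
    by (simp add: compact_Int_closed)
qed

text \<open>Puts the uncertainty into the same space as the productions, so that the variable cost
  becomes an inner product.\<close>

definition unit_costs :: "real^'n \<Rightarrow> real^'n \<Rightarrow> real^'t^'n \<Rightarrow> real^'t^'n" where
  "unit_costs cvar a u = (\<chi> i t. cvar $ i + a $ i * u $ i $ t)"

text \<open>Separates off the investment cost, which is constant once \<open>y\<close> is fixed, so
  saddle points of the inner product are saddle points of the total cost.\<close>

lemma total_cost_eq_inner: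
  "total_cost cinv cvar a x y u = (\<Sum>i\<in>UNIV. cinv $ i * y $ i) + unit_costs cvar a u \<bullet> x"
  by (simp add: total_cost_def unit_costs_def inner_vec_def sum.distrib)

lemma compact_unit_costs_image:
  assumes "compact U" shows "compact (unit_costs cvar a ` U)"
  unfolding unit_costs_def
  by (intro compact_continuous_image assms continuous_intros)

text \<open>\<open>unit_costs\<close> is affine in \<open>u\<close>: scaling by \<open>a\<close> is
  linear, adding \<open>cvar\<close> is a translation.\<close>

lemma convex_unit_costs_image:
  assumes "convex U" shows "convex (unit_costs cvar a ` U)"
proof -
  have "linear (\<lambda>u :: real^'a^'b. \<chi> i t. a $ i * u $ i $ t)"
    by (rule linearI) (simp_all add: vec_eq_iff algebra_simps)
  then have "convex ((+) (\<chi> i t. cvar $ i) ` (\<lambda>u. \<chi> i t. a $ i * u $ i $ t) ` U)"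
    using assms by (intro convex_translation convex_linear_image)
  also have "(+) (\<chi> i t. cvar $ i) ` (\<lambda>u. \<chi> i t. a $ i * u $ i $ t) ` U = unit_costs cvar a ` U"
    by (simp add: image_image unit_costs_def plus_vec_def)
  finally show ?thesis .
qed

lemma minimax_total_cost:
  fixes U :: "(real^'t^'n) set"
  assumes U: "compact U" "convex U" "U \<noteq> {}"
  shows "(INF x\<in>feasible_productions d y. SUP u\<in>U. ereal (total_cost cinv cvar a x y u)) =
    (SUP u\<in>U. INF x\<in>feasible_productions d y. ereal (total_cost cinv cvar a x y u))"
    (is "(INF x\<in>?F. SUP u\<in>U. ?K x u) = _")
proof (rule antisym)
  show "(INF x\<in>?F. SUP u\<in>U. ?K x u) \<le> (SUP u\<in>U. INF x\<in>?F. ?K x u)"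
  proof (cases "?F = {}")
    \<comment> \<open>Without feasible productions both sides are \<infinity>; on the right this
      uses that \<open>U\<close> is nonempty.\<close>
    case True
    then show ?thesis using U(3) by simp
  next
    case False
    obtain x w where x: "x \<in> ?F" and w: "w \<in> unit_costs cvar a ` U"
      and min: "\<And>x'. x' \<in> ?F \<Longrightarrow> w \<bullet> x \<le> w \<bullet> x'"
      and max: "\<And>w'. w' \<in> unit_costs cvar a ` U \<Longrightarrow> w' \<bullet> x \<le> w \<bullet> x"
      using bilinear_saddle_point[OF compact_feasible_productions convex_feasible_productions False
          compact_unit_costs_image[OF U(1)] convex_unit_costs_image[OF U(2)]] U(3)
      by (metis image_is_empty)
    \<comment> \<open>A scenario \<open>u\<close> behind the saddle cost \<open>w\<close> is worst
      for \<open>x\<close>, while \<open>x\<close> is optimal for \<open>u\<close>; hence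
      \<open>?K x u\<close> separates the two values.\<close>
    from w obtain u where u: "u \<in> U" "w = unit_costs cvar a u" by auto
    have "(INF x\<in>?F. SUP u\<in>U. ?K x u) \<le> (SUP u\<in>U. ?K x u)"
      using x by (rule INF_lower)
    also have "\<dots> \<le> ?K x u"
      using max u(2) by (intro SUP_least) (simp add: total_cost_eq_inner)
    also have "\<dots> \<le> (INF x\<in>?F. ?K x u)"
      using min u(2) by (intro INF_greatest) (simp add: total_cost_eq_inner)
    also have "\<dots> \<le> (SUP u\<in>U. INF x\<in>?F. ?K x u)"
      using u(1) by (rule SUP_upper)
    finally show ?thesis .
  qed
  \<comment> \<open>Weak duality: each \<open>?K x u\<close> lies between the inner infimum at
    \<open>u\<close> and the inner supremum at \<open>x\<close>.\<close>
  show "(SUP u\<in>U. INF x\<in>?F. ?K x u) \<le> (INF x\<in>?F. SUP u\<in>U. ?K x u)"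
    by (intro SUP_least INF_greatest) (rule order_trans[OF INF_lower SUP_upper])
qed

theorem theorem4p6:
  fixes cinv cvar a :: "real^'n" and d :: "real^'t" and U :: "(real^'t^'n) set"
  assumes "\<And>i. 0 \<le> cinv $ i"
    and "\<And>i. 0 \<le> cvar $ i"
    and "\<And>i. 0 \<le> a $ i"
    and "\<And>t. 0 \<le> d $ t"
    and "uncertainty_set U"
  shows "C_R cinv cvar a d U = C_AR cinv cvar a d U"
proof -
  have U: "compact U" "convex U" "U \<noteq> {}"
    using assms(5)
    by (auto simp: uncertainty_set_def polytope_imp_compact polytope_imp_convex)
  \<comment> \<open>The joint minimum over \<open>(y, x)\<close> is split into nested ones, so that
    the exchange applies for each fixed \<open>y\<close>.\<close>
  have "{(y, x). (\<forall>i. 0 \<le> y $ i) \<and> x \<in> feasible_productions d y} =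
      (SIGMA y:{y :: real^'n. \<forall>i. 0 \<le> y $ i}. feasible_productions d y)"
    by auto
  then have "C_R cinv cvar a d U = (INF y\<in>{y. \<forall>i. 0 \<le> y $ i}.
      INF x\<in>feasible_productions d y. SUP u\<in>U. ereal (total_cost cinv cvar a x y u))"
    by (simp add: C_R_def INF_Sigma case_prod_beta)
  also have "\<dots> = C_AR cinv cvar a d U"
    unfolding C_AR_def minimax_total_cost[OF U] ..
  finally show ?thesis .
qed

end
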